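(* Let $n\ge 1$ be an integer and let $\alpha>0$ be real. (i) If $\mathcal X$ is any random subset of $[n]=\{1,\ldots,n\}$ and $\alpha\ge n-1$, then $\mathcal X_\alpha$ exists. (ii) If $\mathcal X$ is the uniform random singleton subset of $[n]$, i.e. $\mathbb P\{\mathcal X=\{i\}\}=1/n$ for $i=1,\ldots,n$, then $\mathcal X_\alpha$ does not exist for any non-integer $\alpha<n-1$.
   Context: A random subset $\mathcal X$ of $[n]$ is a random variable taking values in the set of all subsets of $[n]$ (the empty set is allowed as a value). Its void functional is $V_{\mathcal X}:2^{[n]}\to[0,1]$, $V_{\mathcal X}(K)=\mathbb P\{\mathcal X\cap K=\emptyset\}$. For $\alpha>0$, we say that $\mathcal X_\alpha$ exists if there is a random subset $\mathcal Y$ of $[n]$ (on some probability space) with $V_{\mathcal Y}(K)=V_{\mathcal X}(K)^\alpha$ for all $K\subseteq[n]$. *)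

theory Defs
  imports "HOL-Probability.Probability"
begin

definition random_subset :: "nat \<Rightarrow> 'a measure \<Rightarrow> ('a \<Rightarrow> nat set) \<Rightarrow> bool" where
  "random_subset n M X \<longleftrightarrow> prob_space M \<and> X \<in> M \<rightarrow>\<^sub>M count_space (Pow {1..n})"

definition void_functional :: "'a measure \<Rightarrow> ('a \<Rightarrow> nat set) \<Rightarrow> nat set \<Rightarrow> real" where
  "void_functional M X K = measure M {\<omega> \<in> space M. X \<omega> \<inter> K = {}}"

(* HOL cannot quantify existentially over types, so the sample space of Y is taken
   inside the type "nat set". This loses nothing: see power_existsI below, which
   accepts a witness over an arbitrary sample type. Note 0 powr \<alpha> = 0, which is the
   intended value of 0 to the power \<alpha> for \<alpha> > 0. *)
definition power_exists :: "nat \<Rightarrow> 'a measure \<Rightarrow> ('a \<Rightarrow> nat set) \<Rightarrow> real \<Rightarrow> bool" where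
  "power_exists n M X \<alpha> \<longleftrightarrow>
    (\<exists>(N :: nat set measure) Y. random_subset n N Y \<and>
       (\<forall>K\<subseteq>{1..n}. void_functional N Y K = void_functional M X K powr \<alpha>))"

definition uniform_singleton :: "nat \<Rightarrow> 'a measure \<Rightarrow> ('a \<Rightarrow> nat set) \<Rightarrow> bool" where
  "uniform_singleton n M X \<longleftrightarrow> random_subset n M X \<and>
    (\<forall>i\<in>{1..n}. measure M {\<omega> \<in> space M. X \<omega> = {i}} = 1 / real n)"

lemma power_existsI:
  fixes N :: "'b measure"
  assumes Y: "random_subset n N Y"
    and V: "\<And>K. K \<subseteq> {1..n} \<Longrightarrow> void_functional N Y K = void_functional M X K powr \<alpha>"
  shows "power_exists n M X \<alpha>"
proof -
  let ?C = "count_space (Pow {1..n})"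
  let ?D = "distr N ?C Y"
  have m: "Y \<in> N \<rightarrow>\<^sub>M ?C" and p: "prob_space N"
    using Y by (auto simp: random_subset_def)
  have r: "random_subset n ?D (\<lambda>A. A)"
    using prob_space.prob_space_distr[OF p m] by (simp add: random_subset_def)
  have "void_functional ?D (\<lambda>A. A) K = void_functional N Y K" for K
  proof -
    have "void_functional ?D (\<lambda>A. A) K = measure N (Y -` {A \<in> Pow {1..n}. A \<inter> K = {}} \<inter> space N)"
      unfolding void_functional_def by (subst measure_distr[OF m]) auto
    also have "Y -` {A \<in> Pow {1..n}. A \<inter> K = {}} \<inter> space N = {\<omega> \<in> space N. Y \<omega> \<inter> K = {}}"
      using measurable_space[OF m] by auto
    finally show ?thesis by (simp add: void_functional_def)
  qed
  with r V show ?thesis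
    unfolding power_exists_def by metis
qed

end

theory Submission
  imports Defs
begin

text \<open>
  Passing to complements turns the void functional of a random subset \<open>X\<close> of \<open>{1..n}\<close> into the
  distribution function \<open>F B = P(X \<subseteq> B)\<close>, whose Moebius inverse
  \<open>\<Sum>B\<subseteq>A. (-1) ^ card (A - B) * F B\<close> is the probability of \<open>X = A\<close>. A set function is therefore
  the distribution function of a random subset exactly when its Moebius inverse is nonnegative (it
  is then called totally monotone) and its value at \<open>{1..n}\<close> is 1. The question becomes for which
  \<open>\<alpha>\<close> the pointwise power \<open>F powr \<alpha>\<close> of such an \<open>F\<close> is again totally monotone.

  Both answers come from one recursion, in the spirit of the theorem of FitzGerald and Horn on
  entrywise powers of positive semidefinite matrices. Split off an element \<open>a\<close> and put
  \<open>G B = F (insert a B) - F B\<close>. The Moebius inverse of \<open>F powr \<alpha>\<close> at \<open>insert a A\<close> is the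
  increment over \<open>0 \<le> t \<le> 1\<close> of the Moebius inverse of \<open>(F + t * G) powr \<alpha>\<close> at \<open>A\<close>, so by the mean
  value theorem (\<open>mobius_powr_mean_value\<close>) it equals \<open>\<alpha>\<close> times the Moebius inverse of
  \<open>(F + t * G) powr (\<alpha> - 1) * G\<close> at \<open>A\<close> for some \<open>t\<close> strictly between 0 and 1. One element of the
  set is traded for one unit of the exponent.

  For the positive part, \<open>F + t * G\<close> and \<open>G\<close> are totally monotone on \<open>A\<close>, and total monotonicity
  survives products (\<open>totally_monotone_mult\<close>). Induction thus reduces the claim to a one-element
  set with exponent \<open>\<alpha> - (n - 1) \<ge> 0\<close>, where it says that such a power is nondecreasing
  (\<open>totally_monotone_powr\<close>).

  For the negative part, \<open>F B\<close> is \<open>card B / n\<close>, so \<open>G\<close> is constant and the same recursion preserves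
  signs. When \<open>card A - 2 < \<alpha> < card A - 1\<close> it ends at a one-element set with an exponent strictly
  between -1 and 0, that is, with a strictly decreasing power; so the Moebius inverse at \<open>A\<close> is
  negative (\<open>mobius_card_powr_neg\<close>). A non-integer \<open>\<alpha> < n - 1\<close> satisfies these bounds for
  \<open>card A = \<lfloor>\<alpha>\<rfloor> + 2 \<le> n\<close>, and a random subset with the required void functional would take the
  value \<open>A\<close> with negative probability.
\<close>

section \<open>Moebius inversion on the subsets of a finite set\<close>

definition mobius :: "('i set \<Rightarrow> real) \<Rightarrow> 'i set \<Rightarrow> real" where
  "mobius F A = (\<Sum>B\<in>Pow A. (-1) ^ card (A - B) * F B)"

lemma mobius_empty [simp]: "mobius F {} = F {}"
  by (simp add: mobius_def)

lemma mobius_cong: "(\<And>B. B \<subseteq> A \<Longrightarrow> F B = G B) \<Longrightarrow> mobius F A = mobius G A"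
  unfolding mobius_def by (rule sum.cong) auto

lemma mobius_add: "mobius (\<lambda>B. F B + G B) A = mobius F A + mobius G A"
  by (simp add: mobius_def algebra_simps sum.distrib)

lemma mobius_diff: "mobius (\<lambda>B. F B - G B) A = mobius F A - mobius G A"
  by (simp add: mobius_def algebra_simps sum_subtractf)

lemma mobius_cmult: "mobius (\<lambda>B. c * F B) A = c * mobius F A"
  by (simp add: mobius_def sum_distrib_left algebra_simps)

lemma sum_Pow_insert:
  fixes f :: "'i set \<Rightarrow> real"
  assumes "finite A" "a \<notin> A"
  shows "sum f (Pow (insert a A)) = sum f (Pow A) + (\<Sum>B\<in>Pow A. f (insert a B))"
proof -
  have "inj_on (insert a) (Pow A)"
    using \<open>a \<notin> A\<close> by (auto simp: inj_on_def)
  moreover have "Pow A \<inter> insert a ` Pow A = {}"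
    using \<open>a \<notin> A\<close> by auto
  ultimately show ?thesis
    using \<open>finite A\<close> by (simp add: Pow_insert sum.union_disjoint sum.reindex)
qed

text \<open>The Moebius inverse is an iterated difference, one for each element. This recursion drives
  every induction below.\<close>

lemma mobius_insert:
  assumes "finite A" "a \<notin> A"
  shows "mobius F (insert a A) = mobius (\<lambda>B. F (insert a B) - F B) A"
proof -
  have drop: "card (insert a A - B) = Suc (card (A - B))" and keep: "insert a A - insert a B = A - B"
    if "B \<in> Pow A" for B
  proof -
    have "insert a A - B = insert a (A - B)"
      using that assms by auto
    then show "card (insert a A - B) = Suc (card (A - B))"
      using assms by simp
  qed (use assms in auto)
  have "mobius F (insert a A) = (\<Sum>B\<in>Pow A. (-1) ^ card (insert a A - B) * F B +
      (-1) ^ card (insert a A - insert a B) * F (insert a B))"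
    by (simp only: mobius_def sum_Pow_insert[OF assms] sum.distrib)
  also have "\<dots> = mobius (\<lambda>B. F (insert a B) - F B) A"
    unfolding mobius_def by (intro sum.cong refl) (simp only: drop keep, simp add: algebra_simps)
  finally show ?thesis .
qed

lemma sum_mobius:
  assumes "finite A"
  shows "(\<Sum>B\<in>Pow A. mobius F B) = F A"
  using assms
proof (induction A arbitrary: F rule: finite_induct)
  case (insert a A)
  have "(\<Sum>B\<in>Pow A. mobius F (insert a B)) = (\<Sum>B\<in>Pow A. mobius (\<lambda>B. F (insert a B) - F B) B)"
    using insert.hyps by (intro sum.cong refl mobius_insert) (auto intro: finite_subset)
  then show ?case
    using insert by (simp add: sum_Pow_insert)
qed simp

lemma mobius_sum_Pow:
  assumes "finite A" and "\<And>B. B \<subseteq> A \<Longrightarrow> F B = sum p (Pow B)"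
  shows "mobius F A = p A"
  using assms
proof (induction A arbitrary: F p rule: finite_induct)
  case (insert a A)
  have "mobius (\<lambda>B. F (insert a B) - F B) A = p (insert a A)"
  proof (rule insert.IH)
    fix B assume "B \<subseteq> A"
    then have "finite B" "a \<notin> B"
      using insert.hyps finite_subset by auto
    moreover have "F (insert a B) = sum p (Pow (insert a B))" "F B = sum p (Pow B)"
      using \<open>B \<subseteq> A\<close> by (auto intro!: insert.prems)
    ultimately show "F (insert a B) - F B = (\<Sum>C\<in>Pow B. p (insert a C))"
      by (simp add: sum_Pow_insert)
  qed
  then show ?case
    using insert.hyps by (simp add: mobius_insert)
qed simp

section \<open>Totally monotone set functions\<close>

definition totally_monotone :: "'i set \<Rightarrow> ('i set \<Rightarrow> real) \<Rightarrow> bool" where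
  "totally_monotone A F \<longleftrightarrow> (\<forall>B\<subseteq>A. 0 \<le> mobius F B)"

lemma totally_monotone_empty [simp]: "totally_monotone {} F \<longleftrightarrow> 0 \<le> F {}"
  by (simp add: totally_monotone_def)

lemma totally_monotone_add:
  "totally_monotone A F \<Longrightarrow> totally_monotone A G \<Longrightarrow> totally_monotone A (\<lambda>B. F B + G B)"
  by (simp add: totally_monotone_def mobius_add)

lemma totally_monotone_cmult:
  "0 \<le> c \<Longrightarrow> totally_monotone A F \<Longrightarrow> totally_monotone A (\<lambda>B. c * F B)"
  by (simp add: totally_monotone_def mobius_cmult)

lemma totally_monotone_nonneg:
  assumes "finite A" "totally_monotone A F" "B \<subseteq> A"
  shows "0 \<le> F B"
proof -
  have "finite B"
    using assms finite_subset by blast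
  then have "F B = (\<Sum>C\<in>Pow B. mobius F C)"
    by (simp add: sum_mobius)
  also have "\<dots> \<ge> 0"
    using assms by (intro sum_nonneg) (auto simp: totally_monotone_def)
  finally show ?thesis .
qed

lemma totally_monotone_insert:
  assumes "finite A" "a \<notin> A"
  shows "totally_monotone (insert a A) F \<longleftrightarrow>
    totally_monotone A F \<and> totally_monotone A (\<lambda>B. F (insert a B) - F B)"
proof -
  have "(\<forall>B\<subseteq>insert a A. P B) \<longleftrightarrow> (\<forall>B\<subseteq>A. P B) \<and> (\<forall>B\<subseteq>A. P (insert a B))" for P
    by (metis Pow_iff Pow_insert Un_iff image_eqI image_iff)
  moreover have "mobius F (insert a B) = mobius (\<lambda>B. F (insert a B) - F B) B" if "B \<subseteq> A" for B
    using that assms by (intro mobius_insert) (auto intro: finite_subset)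
  ultimately show ?thesis
    by (simp add: totally_monotone_def)
qed

text \<open>Differences in the direction of a new element obey the discrete Leibniz rule
  \<open>d(F G) = dF * (G + dG) + F * dG\<close>, in which every factor is totally monotone on the smaller set.
\<close>

lemma totally_monotone_mult:
  assumes "finite A" "totally_monotone A F" "totally_monotone A G"
  shows "totally_monotone A (\<lambda>B. F B * G B)"
  using assms
proof (induction A arbitrary: F G rule: finite_induct)
  case (insert a A)
  let ?dF = "\<lambda>B. F (insert a B) - F B" and ?dG = "\<lambda>B. G (insert a B) - G B"
  have F: "totally_monotone A F" "totally_monotone A ?dF"
    and G: "totally_monotone A G" "totally_monotone A ?dG"
    using insert.prems insert.hyps by (auto simp: totally_monotone_insert)
  have "totally_monotone A (\<lambda>B. ?dF B * (G B + ?dG B) + F B * ?dG B)"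
    using F G by (intro totally_monotone_add insert.IH)
  then have "totally_monotone A (\<lambda>B. F (insert a B) * G (insert a B) - F B * G B)"
    by (simp add: algebra_simps)
  then show ?case
    using insert.hyps insert.IH F G by (simp add: totally_monotone_insert)
qed simp

section \<open>Powers of totally monotone set functions\<close>

text \<open>This is the mean value theorem on \<open>[0, 1]\<close> for the Moebius inverse of the power of
  \<open>F + t * (H - F)\<close>, which is linear in the values of that power. Working in the open interval
  keeps the base positive wherever \<open>F\<close> and \<open>H\<close> do not both vanish, so exponents \<open>\<alpha> < 1\<close> are covered
  although the power is not differentiable at 0.\<close>

lemma mobius_powr_mean_value:
  fixes F H :: "'i set \<Rightarrow> real"
  assumes "0 < \<alpha>" and FH: "\<And>B. B \<subseteq> A \<Longrightarrow> 0 \<le> F B \<and> F B \<le> H B"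
  obtains t where "0 < t" "t < 1"
    "mobius (\<lambda>B. H B powr \<alpha> - F B powr \<alpha>) A =
     \<alpha> * mobius (\<lambda>B. (F B + t * (H B - F B)) powr (\<alpha> - 1) * (H B - F B)) A"
proof -
  let ?h = "\<lambda>t. mobius (\<lambda>B. (F B + t * (H B - F B)) powr \<alpha>) A"
  let ?h' = "\<lambda>t. mobius (\<lambda>B. \<alpha> * ((F B + t * (H B - F B)) powr (\<alpha> - 1) * (H B - F B))) A"
  have deriv: "((\<lambda>t. (F B + t * (H B - F B)) powr \<alpha>) has_real_derivative
      \<alpha> * ((F B + t * (H B - F B)) powr (\<alpha> - 1) * (H B - F B))) (at t)"
    if "0 < t" "B \<subseteq> A" for t B
  proof (cases "F B + t * (H B - F B) = 0")
    case True
    \<comment> \<open>The base is a sum of two nonnegative terms, so here it vanishes for every \<open>t\<close>.\<close>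
    have "0 \<le> t * (H B - F B)"
      using that FH by simp
    with True FH[OF \<open>B \<subseteq> A\<close>] have "F B = 0" "t * (H B - F B) = 0"
      by linarith+
    then have "F B = 0" "H B = 0"
      using \<open>0 < t\<close> by auto
    then show ?thesis
      by simp
  next
    case False
    have "0 \<le> t * (H B - F B)"
      using that FH by simp
    with False FH[OF \<open>B \<subseteq> A\<close>] have "0 < F B + t * (H B - F B)"
      by linarith
    then show ?thesis
      by (auto intro!: derivative_eq_intros)
  qed
  have "(?h has_derivative (\<lambda>x. x * ?h' t)) (at t)" if "0 < t" "t < 1" for t
  proof -
    have "(?h has_real_derivative ?h' t) (at t)"
      unfolding mobius_def
      by (rule DERIV_sum DERIV_cmult deriv | use that in simp)+
    then show ?thesis
      by (simp add: has_field_derivative_def mult.commute[of _ "?h' t"])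
  qed
  moreover have "continuous_on {0..1} ?h"
    unfolding mobius_def using \<open>0 < \<alpha>\<close> FH
    by (intro continuous_intros continuous_on_powr') auto
  ultimately obtain t where "t \<in> {0<..<1}" "?h 1 - ?h 0 = (1 - 0) * ?h' t"
    using mvt[of 0 1 ?h "\<lambda>t x. x * ?h' t"] by auto
  then show ?thesis
    by (intro that[of t]) (auto simp: mobius_diff mobius_cmult)
qed

text \<open>Removing an element lowers both the cardinality and, through the derivative, the exponent by
  one, so the bound on \<open>\<alpha>\<close> is exactly what the induction preserves.\<close>

lemma totally_monotone_powr:
  assumes "finite A" "totally_monotone A F" "real (card A) - 1 \<le> \<alpha>"
  shows "totally_monotone A (\<lambda>B. F B powr \<alpha>)"
  using assms
proof (induction A arbitrary: F \<alpha> rule: finite_induct)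
  case (insert a A)
  define G where "G = (\<lambda>B. F (insert a B) - F B)"
  have card: "real (card A) \<le> \<alpha>"
    using insert by simp
  have F: "totally_monotone A F" and G: "totally_monotone A G"
    using insert.prems insert.hyps by (auto simp: totally_monotone_insert G_def)
  note nonneg = totally_monotone_nonneg[OF insert.hyps(1)]
  have "totally_monotone A (\<lambda>B. F (insert a B) powr \<alpha> - F B powr \<alpha>)"
  proof (cases "A = {}")
    \<comment> \<open>Here \<open>\<alpha>\<close> may be 0, which the mean value argument excludes; monotonicity of the power is
      enough.\<close>
    case True
    then show ?thesis
      using card F G by (simp add: G_def powr_mono2)
  next
    case False
    then have "0 < \<alpha>"
      using card insert.hyps by (metis card_gt_0_iff of_nat_0_less_iff less_le_trans)
    show ?thesis
      unfolding totally_monotone_def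
    proof (intro allI impI)
      fix B assume "B \<subseteq> A"
      have FH: "0 \<le> F C \<and> F C \<le> F (insert a C)" if "C \<subseteq> B" for C
        using nonneg[OF F, of C] nonneg[OF G, of C] that \<open>B \<subseteq> A\<close> by (auto simp: G_def)
      obtain t where t: "0 < t" "t < 1"
        "mobius (\<lambda>C. F (insert a C) powr \<alpha> - F C powr \<alpha>) B =
         \<alpha> * mobius (\<lambda>C. (F C + t * G C) powr (\<alpha> - 1) * G C) B"
        unfolding G_def by (rule mobius_powr_mean_value[OF \<open>0 < \<alpha>\<close> FH])
      have "totally_monotone A (\<lambda>C. (F C + t * G C) powr (\<alpha> - 1) * G C)"
        using F G t(1) card insert.hyps(1)
        by (intro totally_monotone_mult insert.IH totally_monotone_add totally_monotone_cmult) auto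
      then show "0 \<le> mobius (\<lambda>C. F (insert a C) powr \<alpha> - F C powr \<alpha>) B"
        using t(3) \<open>0 < \<alpha>\<close> \<open>B \<subseteq> A\<close> by (simp add: totally_monotone_def)
    qed
  qed
  moreover have "totally_monotone A (\<lambda>B. F B powr \<alpha>)"
    using insert.IH[OF F] card by simp
  ultimately show ?case
    using insert.hyps by (simp add: totally_monotone_insert)
qed simp

text \<open>The case of interest is \<open>x = 0\<close>. The shift \<open>x\<close> is there for the induction: the intermediate
  point \<open>t > 0\<close> of the mean value theorem is added to it, so that in the last step, where the
  exponent is negative, the power is evaluated away from its singularity at 0.\<close>

lemma mobius_card_powr_neg:
  fixes x \<alpha> :: real
  assumes "finite A" "A \<noteq> {}" "real (card A) - 2 < \<alpha>" "\<alpha> < real (card A) - 1"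
    and "0 \<le> x" "0 < x \<or> 0 < \<alpha>"
  shows "mobius (\<lambda>B. (x + real (card B)) powr \<alpha>) A < 0"
  using assms
proof (induction A arbitrary: x \<alpha> rule: finite_ne_induct)
  case (singleton a)
  then show ?case
    by (simp add: mobius_insert powr_less_mono2_neg)
next
  case (insert a A)
  have card: "card (insert a B) = Suc (card B)" if "B \<subseteq> A" for B
    using that insert.hyps by (metis card_insert_disjoint finite_subset subsetD)
  have bounds: "real (card A) - 1 < \<alpha>" "\<alpha> < real (card A)"
    using insert.prems card[of A] by auto
  have "0 < card A"
    using insert.hyps by (simp add: card_gt_0_iff)
  then have "0 < \<alpha>"
    using bounds by linarith
  let ?F = "\<lambda>B. x + real (card B)"
  obtain t where t: "0 < t" "t < 1"
    "mobius (\<lambda>B. (?F B + 1) powr \<alpha> - ?F B powr \<alpha>) A =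
     \<alpha> * mobius (\<lambda>B. (?F B + t * (?F B + 1 - ?F B)) powr (\<alpha> - 1) * (?F B + 1 - ?F B)) A"
    by (rule mobius_powr_mean_value[OF \<open>0 < \<alpha>\<close>, of A ?F "\<lambda>B. ?F B + 1"])
      (use insert.prems in auto)
  have "mobius (\<lambda>B. ?F B powr \<alpha>) (insert a A) =
      mobius (\<lambda>B. (?F B + 1) powr \<alpha> - ?F B powr \<alpha>) A"
    using insert.hyps by (simp add: mobius_insert) (intro mobius_cong, simp add: card algebra_simps)
  also have "\<dots> = \<alpha> * mobius (\<lambda>B. ((x + t) + real (card B)) powr (\<alpha> - 1)) A"
    using t(3) by (simp add: algebra_simps)
  also have "\<dots> < 0"
    using insert.IH[of "\<alpha> - 1" "x + t"] bounds t(1) insert.prems \<open>0 < \<alpha>\<close>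
    by (simp add: mult_pos_neg)
  finally show ?case .
qed

section \<open>Void functionals of random subsets\<close>

lemma void_functional_Diff:
  assumes "random_subset n M X" "B \<subseteq> {1..n}"
  shows "void_functional M X ({1..n} - B) = (\<Sum>C\<in>Pow B. measure M {\<omega> \<in> space M. X \<omega> = C})"
proof -
  interpret prob_space M
    using assms by (simp add: random_subset_def)
  have X: "X \<in> M \<rightarrow>\<^sub>M count_space (Pow {1..n})"
    using assms by (simp add: random_subset_def)
  have sets: "{\<omega> \<in> space M. X \<omega> = C} \<in> sets M" if "C \<in> Pow B" for C
  proof -
    have "X -` {C} \<inter> space M \<in> sets M"
      using that assms(2) by (intro measurable_sets[OF X]) auto
    also have "X -` {C} \<inter> space M = {\<omega> \<in> space M. X \<omega> = C}"
      by auto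
    finally show ?thesis .
  qed
  have fin: "finite (Pow B)"
    using assms(2) finite_subset by auto
  have "X \<omega> \<subseteq> {1..n}" if "\<omega> \<in> space M" for \<omega>
    using measurable_space[OF X that] by simp
  then have "{\<omega> \<in> space M. X \<omega> \<inter> ({1..n} - B) = {}} = (\<Union>C\<in>Pow B. {\<omega> \<in> space M. X \<omega> = C})"
    by auto
  moreover have "measure M (\<Union>C\<in>Pow B. {\<omega> \<in> space M. X \<omega> = C}) =
      (\<Sum>C\<in>Pow B. measure M {\<omega> \<in> space M. X \<omega> = C})"
    using sets fin by (intro finite_measure_finite_Union) (auto simp: disjoint_family_on_def)
  ultimately show ?thesis
    by (simp add: void_functional_def)
qed

lemma mobius_void_functional:
  assumes "random_subset n M X" "A \<subseteq> {1..n}"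
  shows "mobius (\<lambda>B. void_functional M X ({1..n} - B)) A = measure M {\<omega> \<in> space M. X \<omega> = A}"
proof (rule mobius_sum_Pow[where p = "\<lambda>C. measure M {\<omega> \<in> space M. X \<omega> = C}"])
  show "finite A"
    using assms(2) finite_subset by blast
next
  fix B assume "B \<subseteq> A"
  then show "void_functional M X ({1..n} - B) = (\<Sum>C\<in>Pow B. measure M {\<omega> \<in> space M. X \<omega> = C})"
    using assms by (intro void_functional_Diff) auto
qed

lemma void_functional_empty:
  "random_subset n M X \<Longrightarrow> void_functional M X {} = 1"
  by (simp add: random_subset_def void_functional_def prob_space.prob_space)

text \<open>The Moebius inverse of \<open>F\<close> serves as the point masses, which by inversion have total mass
  \<open>F {1..n}\<close>.\<close>

lemma random_subset_of_totally_monotone: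
  assumes tm: "totally_monotone {1..n} F" and one: "F {1..n} = 1"
  obtains N :: "nat set measure"
  where "random_subset n N (\<lambda>A. A)"
    "\<And>K. K \<subseteq> {1..n} \<Longrightarrow> void_functional N (\<lambda>A. A) K = F ({1..n} - K)"
proof -
  define N where "N = point_measure (Pow {1..n}) (\<lambda>A. ennreal (mobius F A))"
  have emeasure: "emeasure N S = ennreal (\<Sum>A\<in>S. mobius F A)" if "S \<subseteq> Pow {1..n}" for S
  proof -
    have "emeasure N S = (\<Sum>A\<in>S. ennreal (mobius F A))"
      using that by (simp add: N_def emeasure_point_measure_finite)
    also have "\<dots> = ennreal (\<Sum>A\<in>S. mobius F A)"
      using that tm by (intro sum_ennreal) (auto simp: totally_monotone_def)
    finally show ?thesis .
  qed
  have space: "space N = Pow {1..n}"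
    by (simp add: N_def space_point_measure)
  have "emeasure N (space N) = 1"
    using one by (simp add: emeasure space sum_mobius)
  then have "prob_space N"
    by (rule prob_spaceI)
  moreover have "(\<lambda>A. A) \<in> N \<rightarrow>\<^sub>M count_space (Pow {1..n})"
    by (simp add: N_def measurable_def space_point_measure sets_point_measure)
  ultimately have "random_subset n N (\<lambda>A. A)"
    by (simp add: random_subset_def)
  moreover have "void_functional N (\<lambda>A. A) K = F ({1..n} - K)" if "K \<subseteq> {1..n}" for K
  proof -
    have "{A \<in> space N. A \<inter> K = {}} = Pow ({1..n} - K)"
      by (auto simp: space)
    moreover have "emeasure N (Pow ({1..n} - K)) = ennreal (F ({1..n} - K))"
      by (subst emeasure) (auto simp: sum_mobius)
    moreover have "0 \<le> F ({1..n} - K)"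
      using totally_monotone_nonneg[OF _ tm] by auto
    ultimately show ?thesis
      by (simp add: void_functional_def measure_def)
  qed
  ultimately show ?thesis
    by (rule that)
qed

lemma power_exists_if_ge:
  assumes X: "random_subset n M X" and "real n - 1 \<le> \<alpha>"
  shows "power_exists n M X \<alpha>"
proof -
  define F where "F = (\<lambda>B. void_functional M X ({1..n} - B))"
  have "totally_monotone {1..n} F"
    unfolding totally_monotone_def F_def using mobius_void_functional[OF X] by simp
  then have "totally_monotone {1..n} (\<lambda>B. F B powr \<alpha>)"
    using assms(2) by (intro totally_monotone_powr) auto
  moreover have "F {1..n} powr \<alpha> = 1"
    by (simp add: F_def void_functional_empty[OF X])
  ultimately obtain N :: "nat set measure" where N: "random_subset n N (\<lambda>A. A)"
    "\<And>K. K \<subseteq> {1..n} \<Longrightarrow> void_functional N (\<lambda>A. A) K = F ({1..n} - K) powr \<alpha>"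
    by (rule random_subset_of_totally_monotone) blast
  moreover have "F ({1..n} - K) = void_functional M X K" if "K \<subseteq> {1..n}" for K
    using that by (simp add: F_def double_diff)
  ultimately show ?thesis
    by (intro power_existsI[OF N(1)]) simp
qed

lemma void_functional_uniform_singleton:
  assumes "n \<ge> 1" "uniform_singleton n M X" "B \<subseteq> {1..n}"
  shows "void_functional M X ({1..n} - B) = real (card B) / real n"
proof -
  define p where "p = (\<lambda>C. measure M {\<omega> \<in> space M. X \<omega> = C})"
  define S where "S = (\<lambda>B. (\<lambda>i. {i}) ` B :: nat set set)"
  have p1: "p {i} = 1 / real n" if "i \<in> {1..n}" for i
    using assms(2) that by (simp add: uniform_singleton_def p_def)
  have X: "random_subset n M X"
    using assms(2) by (simp add: uniform_singleton_def)
  have sum_S: "sum p (S C) = real (card C) / real n" if "C \<subseteq> {1..n}" for C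
  proof -
    have "sum p (S C) = (\<Sum>i\<in>C. p {i})"
      unfolding S_def by (subst sum.reindex) (auto simp: inj_on_def)
    also have "\<dots> = (\<Sum>i\<in>C. 1 / real n)"
      using that p1 by (intro sum.cong) auto
    finally show ?thesis
      by simp
  qed
  have S_sub: "S C \<subseteq> Pow C" for C
    by (auto simp: S_def)
  \<comment> \<open>The singletons already carry the whole mass, so every other value has probability 0.\<close>
  have "sum p (Pow {1..n}) = 1"
    using void_functional_Diff[OF X, of "{1..n}"] void_functional_empty[OF X] by (simp add: p_def)
  moreover have "sum p (S {1..n}) = 1"
    using sum_S[of "{1..n}"] assms(1) by simp
  ultimately have "sum p (Pow {1..n} - S {1..n}) = 0"
    using S_sub by (subst sum_diff) auto
  then have zero: "p C = 0" if "C \<in> Pow {1..n} - S {1..n}" for C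
    using that by (subst (asm) sum_nonneg_eq_0_iff) (auto simp: p_def)
  have "sum p (Pow B) = sum p (S B)"
  proof (rule sum.mono_neutral_right)
    show "finite (Pow B)"
      using assms(3) finite_subset by auto
    show "\<forall>C\<in>Pow B - S B. p C = 0"
      using assms(3) by (auto intro!: zero simp: S_def)
  qed (rule S_sub)
  then show ?thesis
    using void_functional_Diff[OF X assms(3)] sum_S[OF assms(3)] by (simp add: p_def)
qed

lemma not_power_exists_uniform_singleton:
  assumes X: "uniform_singleton n M X" and \<alpha>: "0 < \<alpha>" "\<alpha> \<notin> \<int>" "\<alpha> < real n - 1"
  shows "\<not> power_exists n M X \<alpha>"
proof
  assume "power_exists n M X \<alpha>"
  then obtain N :: "nat set measure" and Y where Y: "random_subset n N Y"
    and V: "\<And>K. K \<subseteq> {1..n} \<Longrightarrow> void_functional N Y K = void_functional M X K powr \<alpha>"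
    unfolding power_exists_def by blast
  \<comment> \<open>The unique cardinality for which \<open>\<alpha>\<close> lies strictly between \<open>m - 2\<close> and \<open>m - 1\<close>; it is at
    most \<open>n\<close> because \<open>\<alpha> < n - 1\<close>.\<close>
  define m where "m = nat \<lfloor>\<alpha>\<rfloor> + 2"
  have "real_of_int \<lfloor>\<alpha>\<rfloor> < \<alpha>"
    using \<alpha>(2) by (metis Ints_of_int floor_correct order_le_less)
  moreover have "real m = real_of_int \<lfloor>\<alpha>\<rfloor> + 2"
    using \<alpha>(1) by (simp add: m_def)
  ultimately have m: "real m - 2 < \<alpha>" "\<alpha> < real m - 1" "real m < real n + 1"
    using \<alpha>(3) floor_correct[of \<alpha>] by linarith+
  then have sub: "{1..m} \<subseteq> {1..n}"
    by auto
  have "n \<ge> 1"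
    using \<alpha> by linarith
  have "measure N {\<omega> \<in> space N. Y \<omega> = {1..m}} =
      mobius (\<lambda>B. void_functional N Y ({1..n} - B)) {1..m}"
    by (rule mobius_void_functional[OF Y sub, symmetric])
  also have "\<dots> = mobius (\<lambda>B. (1 / real n powr \<alpha>) * (0 + real (card B)) powr \<alpha>) {1..m}"
  proof (rule mobius_cong)
    fix B assume "B \<subseteq> {1..m}"
    then have "B \<subseteq> {1..n}"
      using sub by blast
    then show "void_functional N Y ({1..n} - B) = (1 / real n powr \<alpha>) * (0 + real (card B)) powr \<alpha>"
      by (simp add: V void_functional_uniform_singleton[OF \<open>n \<ge> 1\<close> X] powr_divide
          del: One_nat_def)
  qed
  also have "\<dots> = (1 / real n powr \<alpha>) * mobius (\<lambda>B. (0 + real (card B)) powr \<alpha>) {1..m}"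
    by (rule mobius_cmult)
  also have "\<dots> < 0"
  proof (rule mult_pos_neg)
    show "mobius (\<lambda>B. (0 + real (card B)) powr \<alpha>) {1..m} < 0"
      using m \<alpha>(1) by (intro mobius_card_powr_neg) (auto simp: m_def)
  qed (use \<open>n \<ge> 1\<close> in simp)
  finally show False
    using measure_nonneg[of N "{\<omega> \<in> space N. Y \<omega> = {1..m}}"] by linarith
qed

theorem theorem3:
  fixes n :: nat and \<alpha> :: real
  assumes "n \<ge> 1" and "\<alpha> > 0"
  shows "(\<forall>(M :: 'a measure) X. random_subset n M X \<longrightarrow> \<alpha> \<ge> real n - 1 \<longrightarrow> power_exists n M X \<alpha>) \<and>
         (\<forall>(M :: 'b measure) X. uniform_singleton n M X \<longrightarrow> \<alpha> \<notin> \<int> \<longrightarrow> \<alpha> < real n - 1 \<longrightarrow>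
            \<not> power_exists n M X \<alpha>)"
  using assms by (auto intro: power_exists_if_ge dest: not_power_exists_uniform_singleton)

end
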